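(* Let $a$ and $k$ be positive integers. Then the Bernoulli numbers satisfy the recursion formula $$\frac{2^{k+1}-1}{k+1}B_{k+1}=\sum_{n=0}^{a-1} (-1)^n(n+1)^k+\frac{(-1)^a}{2}a^k+(-1)^a\sum_{j=1}^{k}\binom{k}{j} a^{k-j}\,\frac{2^{j+1}-1}{j+1}B_{j+1}.$$
   Context: The Bernoulli numbers $B_n$ are defined by $\frac{z}{e^z-1}=\sum_{k=0}^\infty \frac{B_k}{k!}z^k$ for $|z|<2\pi$; thus $B_0=1$, $B_1=-\frac12$, $B_2=\frac16$. *)

theory Defs
  imports "HOL-Complex_Analysis.Complex_Analysis"
begin

(* The function z / (exp z - 1) has a removable singularity at 0; HOL's value there is
   0 / 0 = 0, so the identity is required on the punctured disc only. *)
definition bernoulli_generating :: "(nat \<Rightarrow> real) \<Rightarrow> bool" where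
  "bernoulli_generating B \<longleftrightarrow>
     (\<forall>z :: complex. 0 < norm z \<longrightarrow> norm z < 2 * pi \<longrightarrow>
        (\<lambda>k. complex_of_real (B k) / fact k * z ^ k) sums (z / (exp z - 1)))"

definition bernoulli :: "nat \<Rightarrow> real" where
  "bernoulli = (THE B. bernoulli_generating B)"

lemma powser_punctured_unique:
  fixes c d :: "nat \<Rightarrow> complex"
  assumes r: "r > 0"
    and c: "\<And>z. 0 < norm z \<Longrightarrow> norm z < r \<Longrightarrow> (\<lambda>n. c n * z ^ n) sums f z"
    and d: "\<And>z. 0 < norm z \<Longrightarrow> norm z < r \<Longrightarrow> (\<lambda>n. d n * z ^ n) sums f z"
  shows "c = d"
proof -
  define h where "h n = c n - d n" for n
  have h: "(\<lambda>n. h n * z ^ n) sums 0" if "0 < norm z" "norm z < r" for z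
    using sums_diff[OF c[OF that] d[OF that]] by (simp add: h_def algebra_simps)
  have cont: "((\<lambda>z. \<Sum>n. h n * z ^ n) \<longlongrightarrow> (\<Sum>n. h n * 0 ^ n)) (at 0)"
  proof -
    have "summable (\<lambda>n. h n * (of_real (r / 2)) ^ n)"
      using h[of "of_real (r / 2)"] r by (auto simp: sums_iff)
    then have "isCont (\<lambda>z. \<Sum>n. h n * z ^ n) 0"
      by (rule isCont_powser) (use r in auto)
    then show ?thesis by (simp add: isCont_def)
  qed
  have "eventually (\<lambda>z::complex. (\<Sum>n. h n * z ^ n) = 0) (at 0)"
    unfolding eventually_at
    by (rule exI[of _ r]) (use r h in \<open>auto simp: sums_iff\<close>)
  then have "((\<lambda>z. \<Sum>n. h n * z ^ n) \<longlongrightarrow> 0) (at 0)"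
    by (rule tendsto_eventually)
  with cont have "(\<Sum>n. h n * 0 ^ n) = 0"
    using tendsto_unique at_neq_bot by blast
  then have h0: "h 0 = 0" by (simp add: powser_zero)
  have hs: "(\<lambda>n. h n * (z - 0) ^ n) sums 0" if "norm (z - 0) < r" for z :: complex
    using h[of z] that powser_sums_zero[of h] h0 by (cases "z = 0") auto
  have "h m = 0" for m
  proof (rule ccontr)
    assume m: "h m \<noteq> 0"
    then have "m > 0" using h0 by (cases m) auto
    show False
    proof (rule powser_0_nonzero[of r 0 h "\<lambda>_. 0" m])
      fix s :: real
      assume s: "0 < s" "\<And>z::complex. z \<in> cball 0 s - {0} \<Longrightarrow> (0::complex) \<noteq> 0"
      show False using s(2)[of "of_real s"] s(1) by auto
    qed (use r hs m \<open>m > 0\<close> in auto)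
  qed
  then show ?thesis by (auto simp: h_def)
qed

lemma bernoulli_generating_unique:
  assumes "bernoulli_generating B" "bernoulli_generating B'"
  shows "B = B'"
proof
  fix n
  have "(\<lambda>k. complex_of_real (B k) / fact k) = (\<lambda>k. complex_of_real (B' k) / fact k)"
    by (rule powser_punctured_unique[of "2 * pi" _ "\<lambda>z. z / (exp z - 1)"])
       (use assms in \<open>auto simp: bernoulli_generating_def\<close>)
  from fun_cong[OF this, of n] show "B n = B' n" by simp
qed

lemma bernoulli_generating_exists: "\<exists>B. bernoulli_generating B"
proof -
  let ?f = "\<lambda>z::complex. z / (exp z - 1)"
  have nz: "exp z \<noteq> 1" if "z \<noteq> 0" "norm z < 2 * pi" for z :: complex
  proof
    assume "exp z = 1"
    then obtain n :: int where n: "Re z = 0" "Im z = of_int (2 * n) * pi"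
      by (auto simp: exp_eq_1)
    with that(1) have "n \<noteq> 0" by (auto simp: complex_eq_iff)
    then have "1 \<le> \<bar>real_of_int n\<bar>" by linarith
    then have "2 * pi \<le> \<bar>Im z\<bar>" using n by (simp add: abs_mult)
    with abs_Im_le_cmod[of z] that(2) show False by linarith
  qed
  have "((\<lambda>z::complex. (exp (0 + z) - exp 0) / z) \<longlongrightarrow> exp 0) (at 0)"
    using DERIV_exp[of "0::complex"] unfolding DERIV_def .
  then have "((\<lambda>z::complex. inverse ((exp z - 1) / z)) \<longlongrightarrow> inverse 1) (at 0)"
    by (intro tendsto_inverse) auto
  then have lim: "?f \<midarrow>0\<rightarrow> 1" by simp
  define g where "g z = (if z = 0 then 1 else ?f z)" for z
  have "g holomorphic_on ball 0 (2 * pi)"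
    unfolding g_def
    by (rule removable_singularity[OF _ _ lim]) (auto intro!: holomorphic_intros simp: nz)
  then have "(\<lambda>n. (deriv ^^ n) g 0 / fact n * (z - 0) ^ n) sums g z"
    if "z \<in> ball 0 (2 * pi)" for z
    by (rule holomorphic_power_series) (use that in auto)
  then have s: "(\<lambda>n. (deriv ^^ n) g 0 / fact n * z ^ n) sums ?f z"
    if "0 < norm z" "norm z < 2 * pi" for z
    using that by (force simp: g_def)
  define c where "c n = (deriv ^^ n) g 0" for n
  have "(\<lambda>n. cnj (c n / fact n)) = (\<lambda>n. c n / fact n)"
  proof (rule powser_punctured_unique[of "2 * pi" _ ?f])
    fix z :: complex assume z: "0 < norm z" "norm z < 2 * pi"
    have "(\<lambda>n. cnj (c n / fact n * cnj z ^ n)) sums cnj (?f (cnj z))"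
      unfolding sums_cnj using s[of "cnj z"] z by (simp add: c_def)
    then show "(\<lambda>n. cnj (c n / fact n) * z ^ n) sums ?f z"
      by (simp add: exp_cnj)
  qed (use s in \<open>auto simp: c_def\<close>)
  then have "cnj (c n) = c n" for n
    by (drule_tac fun_cong[of _ _ n]) simp
  then have "complex_of_real (Re (c n)) = c n" for n
    by (metis Reals_cnj_iff of_real_Re)
  then have "bernoulli_generating (\<lambda>n. Re (c n))"
    using s by (simp add: bernoulli_generating_def c_def)
  then show ?thesis by blast
qed

lemma bernoulli_generating_bernoulli: "bernoulli_generating bernoulli"
  unfolding bernoulli_def
  by (rule theI'[of bernoulli_generating]) (use bernoulli_generating_exists bernoulli_generating_unique in blast)

end

theory Submission
  imports Defs
begin

text \<open>
  Put \<open>g j = (2 ^ (j + 1) - 1) / (j + 1) * bernoulli (j + 1)\<close>. Since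
  \<open>1 / (exp z + 1) = 1 / (exp z - 1) - 2 / (exp (2 * z) - 1)\<close>, the exponential generating
  function of \<open>g\<close> is \<open>- 1 / (exp z + 1)\<close>. Hence the binomial convolution
  \<open>T a = (\<Sum>j\<le>k. (k choose j) * a ^ (k - j) * g j)\<close> satisfies \<open>T (a + 1) + T a = - (a ^ k)\<close>,
  and unfolding this recurrence down to \<open>T 0 = g k\<close> gives the formula.
\<close>

text \<open>This passes from the analytic definition to formal power series: the Cauchy product of
  the series of \<open>z / (exp z - 1)\<close> and \<open>exp z - 1\<close> sums to \<open>z\<close>
  on the punctured disc, and coefficients are unique there.\<close>

lemma bernoulli_fps:
  "Abs_fps (\<lambda>n. bernoulli n / fact n) * (fps_exp 1 - 1) = fps_X"
proof -
  define c where "c n = complex_of_real (bernoulli n) / fact n" for n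
  define e where "e n = (fps_exp 1 - 1 :: complex fps) $ n" for n
  have c_sums: "(\<lambda>n. c n * z ^ n) sums (z / (exp z - 1))"
    if "0 < norm z" "norm z < 2 * pi" for z
    using bernoulli_generating_bernoulli that by (simp add: bernoulli_generating_def c_def)
  have e_sums: "(\<lambda>n. e n * z ^ n) sums (exp z - 1)" for z :: complex
  proof -
    have "(\<lambda>n. z ^ n /\<^sub>R fact n - (if n = 0 then 1 else 0)) sums (exp z - 1)"
      by (intro sums_diff exp_converges sums_single)
    also have "(\<lambda>n. z ^ n /\<^sub>R fact n - (if n = 0 then 1 else 0)) = (\<lambda>n. e n * z ^ n)"
      by (auto simp: e_def fun_eq_iff scaleR_conv_of_real field_simps)
    finally show ?thesis .
  qed
  have "(\<lambda>n. \<Sum>i\<le>n. c i * e (n - i)) = (\<lambda>n. fps_X $ n)"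
  proof (rule powser_punctured_unique[of "2 * pi" _ "\<lambda>z. z"])
    fix z :: complex assume z: "0 < norm z" "norm z < 2 * pi"
    \<comment> \<open>A point of the disc farther out than \<open>z\<close>: convergence at
      \<open>w\<close> gives the absolute convergence at \<open>z\<close> that the Cauchy product
      requires.\<close>
    define w where "w = complex_of_real ((norm z + 2 * pi) / 2)"
    have w: "norm z < norm w" "0 < norm w" "norm w < 2 * pi"
      using z pi_gt_zero unfolding w_def norm_of_real by (simp_all add: abs_of_pos add_pos_pos)
    have "exp z - 1 \<noteq> 0"
    proof
      assume "exp z - 1 = 0"
      then obtain n :: int where n: "Re z = 0" "Im z = of_int (2 * n) * pi"
        by (auto simp: exp_eq_1)
      with z(1) have "n \<noteq> 0" by (auto simp: complex_eq_iff)
      then have "1 \<le> \<bar>real_of_int n\<bar>" by linarith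
      then have "2 * pi \<le> \<bar>Im z\<bar>" using n by (simp add: abs_mult)
      with abs_Im_le_cmod[of z] z(2) show False by linarith
    qed
    moreover have "summable (\<lambda>n. norm (c n * z ^ n))"
      using powser_insidea[OF sums_summable[OF c_sums[OF w(2,3)]] w(1)] .
    moreover have "summable (\<lambda>n. norm (e n * z ^ n))"
      using powser_insidea[OF sums_summable[OF e_sums] w(1)] .
    ultimately have "(\<lambda>n. \<Sum>i\<le>n. (c i * z ^ i) * (e (n - i) * z ^ (n - i))) sums z"
      using Cauchy_product_sums[of "\<lambda>n. c n * z ^ n" "\<lambda>n. e n * z ^ n"]
        c_sums[OF z] e_sums[of z] by (simp add: sums_iff)
    also have "(\<lambda>n. \<Sum>i\<le>n. (c i * z ^ i) * (e (n - i) * z ^ (n - i))) =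
        (\<lambda>n. (\<Sum>i\<le>n. c i * e (n - i)) * z ^ n)"
      unfolding sum_distrib_right
    proof (intro ext sum.cong refl)
      fix n i :: nat assume "i \<in> {..n}"
      then have "z ^ n = z ^ i * z ^ (n - i)" by (simp add: power_add[symmetric])
      then show "(c i * z ^ i) * (e (n - i) * z ^ (n - i)) = c i * e (n - i) * z ^ n" by simp
    qed
    finally show "(\<lambda>n. (\<Sum>i\<le>n. c i * e (n - i)) * z ^ n) sums z" .
    have "(\<lambda>n. if n = 1 then z ^ n else 0) sums z ^ 1"
      by (rule sums_single)
    also have "(\<lambda>n. if n = 1 then z ^ n else 0) = (\<lambda>n. fps_X $ n * z ^ n)"
      by (auto simp: fps_X_def)
    finally show "(\<lambda>n. fps_X $ n * z ^ n) sums z" by simp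
  qed simp
  then have c_conv: "(\<Sum>i\<le>n. c i * e (n - i)) = fps_X $ n" for n
    by (rule fun_cong)
  show ?thesis
  proof (rule fps_ext)
    fix n
    have e_real: "e i = complex_of_real ((fps_exp 1 - 1) $ i)" for i
      by (simp add: e_def)
    have "complex_of_real ((Abs_fps (\<lambda>n. bernoulli n / fact n) * (fps_exp 1 - 1)) $ n) =
        (\<Sum>i\<le>n. c i * e (n - i))"
      unfolding fps_mult_nth e_real by (simp add: c_def atLeast0AtMost)
    also have "\<dots> = complex_of_real (fps_X $ n)"
      unfolding c_conv by (simp add: fps_X_def)
    finally show "(Abs_fps (\<lambda>n. bernoulli n / fact n) * (fps_exp 1 - 1)) $ n = fps_X $ n"
      unfolding of_real_eq_iff .
  qed
qed

text \<open>This is \<open>- 1 / 2\<close> times the value at 0 of the Euler polynomial of degree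
  \<open>j\<close>.\<close>

definition bernoulli_diff :: "nat \<Rightarrow> real" where
  "bernoulli_diff j = (2 ^ (j + 1) - 1) / real (j + 1) * bernoulli (j + 1)"

lemma bernoulli_diff_fps:
  "Abs_fps (\<lambda>j. bernoulli_diff j / fact j) * (fps_exp 1 + 1) = - 1"
proof -
  define E where "E = (fps_exp 1 :: real fps)"
  define B where "B = Abs_fps (\<lambda>n. bernoulli n / fact n)"
  define B2 where "B2 = B oo (fps_const 2 * fps_X)"
  define F where "F = Abs_fps (\<lambda>j. bernoulli_diff j / fact j)"
  have E2: "(fps_exp 2 :: real fps) = E * E"
    unfolding E_def fps_exp_add_mult[symmetric] by simp
  have B: "B * (E - 1) = fps_X"
    unfolding B_def E_def by (rule bernoulli_fps)
  have E_compose: "E oo (fps_const 2 * fps_X) = E * E"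
    unfolding E2[symmetric] by (simp add: E_def)
  have "B2 * (E * E - 1) = (B * (E - 1)) oo (fps_const 2 * fps_X)"
    by (simp add: B2_def fps_compose_mult_distrib fps_compose_sub_distrib E_compose)
  then have B2: "B2 * (E * E - 1) = fps_const 2 * fps_X"
    by (simp add: B)
  have B2_nth: "B2 $ n = 2 ^ n * B $ n" for n
    unfolding B2_def fps_compose_linear by simp
  \<comment> \<open>\<open>B2\<close> is the series of \<open>B\<close> at \<open>2 * z\<close>, so
    the difference carries the factors \<open>2 ^ n - 1\<close>; its constant term vanishes.\<close>
  have XF: "fps_X * F = B2 - B"
  proof (rule fps_ext)
    fix n
    show "(fps_X * F) $ n = (B2 - B) $ n"
    proof (cases n)
      case (Suc m)
      have "bernoulli_diff m / fact m = (2 ^ Suc m - 1) * bernoulli (Suc m) / fact (Suc m)"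
        by (simp add: bernoulli_diff_def)
      then show ?thesis
        by (simp add: Suc F_def B2_nth B_def left_diff_distrib diff_divide_distrib
            del: fact_Suc power_Suc)
    qed (simp add: B2_nth)
  qed
  \<comment> \<open>The factor \<open>fps_X * (E - 1)\<close> clears the denominators of
    \<open>F\<close>, \<open>B\<close> and \<open>B2\<close> at once, as
    \<open>E * E - 1 = (E - 1) * (E + 1)\<close>; it is nonzero and cancels at the end.\<close>
  have "(fps_X * (E - 1)) * (F * (E + 1)) = (fps_X * F) * (E * E - 1)"
    by (simp add: algebra_simps)
  also have "\<dots> = B2 * (E * E - 1) - (B * (E - 1)) * (E + 1)"
    unfolding XF by (simp add: algebra_simps)
  also have "\<dots> = (fps_const 1 + fps_const 1) * fps_X - fps_X * (E + 1)"
    unfolding B B2 fps_const_add by simp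
  also have "\<dots> = (fps_X * (E - 1)) * (- 1)"
    by (simp add: algebra_simps)
  finally have eq: "(fps_X * (E - 1)) * (F * (E + 1)) = (fps_X * (E - 1)) * (- 1)" .
  have "E - 1 \<noteq> 0"
    using B by auto
  then have "fps_X * (E - 1) \<noteq> 0" by simp
  with eq show ?thesis
    unfolding F_def E_def by (simp only: mult_cancel_left) simp
qed

lemma bernoulli_diff_0: "bernoulli_diff 0 = - 1 / 2"
  using arg_cong[OF bernoulli_diff_fps, of "\<lambda>f. fps_nth f 0"] by simp

text \<open>Up to the factor \<open>fact k\<close>, the two sums are coefficients of
  \<open>F * fps_exp (x + 1)\<close> and \<open>F * fps_exp x\<close>, which add up to
  \<open>F * (fps_exp 1 + 1) * fps_exp x = - fps_exp x\<close>.\<close>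

lemma bernoulli_diff_binomial_recurrence:
  fixes x :: real
  shows "(\<Sum>j\<le>k. real (k choose j) * (x + 1) ^ (k - j) * bernoulli_diff j)
    + (\<Sum>j\<le>k. real (k choose j) * x ^ (k - j) * bernoulli_diff j) = - (x ^ k)"
proof -
  define F where "F = Abs_fps (\<lambda>j. bernoulli_diff j / fact j)"
  have nth: "(F * fps_exp y) $ k =
      (\<Sum>j\<le>k. real (k choose j) * y ^ (k - j) * bernoulli_diff j) / fact k" for y
    by (auto simp: F_def fps_mult_nth atLeast0AtMost sum_divide_distrib binomial_fact
        intro!: sum.cong)
  have "F * fps_exp (x + 1) + F * fps_exp x = (F * (fps_exp 1 + 1)) * fps_exp x"
    by (simp add: fps_exp_add_mult algebra_simps)
  also have "\<dots> = - fps_exp x"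
    by (simp add: F_def bernoulli_diff_fps)
  finally have "fps_nth (F * fps_exp (x + 1) + F * fps_exp x) k = fps_nth (- fps_exp x) k"
    by (rule arg_cong)
  then have "(F * fps_exp (x + 1)) $ k + (F * fps_exp x) $ k = - (x ^ k) / fact k"
    unfolding fps_add_nth by simp
  then show ?thesis
    unfolding nth add_divide_distrib[symmetric] by (subst (asm) divide_cancel_right) simp
qed

lemma bernoulli_diff_alternating:
  fixes a k :: nat
  assumes "k > 0"
  shows "bernoulli_diff k = (\<Sum>n<a. (- 1) ^ n * (real n + 1) ^ k) + (- 1) ^ a * real a ^ k
    + (- 1) ^ a * (\<Sum>j\<le>k. real (k choose j) * real a ^ (k - j) * bernoulli_diff j)"
proof (induction a)
  case 0
  \<comment> \<open>Since \<open>0 ^ 0 = 1\<close>, exactly the term \<open>j = k\<close> survives;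
    the separate summand \<open>0 ^ k\<close> vanishes because \<open>k > 0\<close>.\<close>
  have "(\<Sum>j\<le>k. real (k choose j) * 0 ^ (k - j) * bernoulli_diff j) =
      (\<Sum>j\<le>k. if j = k then bernoulli_diff j else 0)"
    by (rule sum.cong) auto
  with assms show ?case by simp
next
  case (Suc a)
  have step: "(\<Sum>j\<le>k. real (k choose j) * real a ^ (k - j) * bernoulli_diff j) = - (real a ^ k)
      - (\<Sum>j\<le>k. real (k choose j) * real (Suc a) ^ (k - j) * bernoulli_diff j)"
    using bernoulli_diff_binomial_recurrence[of k "real a"] by (simp add: add.commute)
  \<comment> \<open>After \<open>step\<close> the powers of \<open>a\<close> cancel, and the new
    summand of the alternating sum cancels the new boundary term in \<open>Suc a\<close>.\<close>
  show ?case
    by (subst Suc.IH, subst step) (simp add: algebra_simps)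
qed

theorem proposition2:
  fixes a k :: nat
  assumes "a > 0" and "k > 0"
  shows "(2 ^ (k + 1) - 1) / real (k + 1) * bernoulli (k + 1) =
    (\<Sum>n<a. (- 1) ^ n * (real n + 1) ^ k)
    + (- 1) ^ a / 2 * real a ^ k
    + (- 1) ^ a * (\<Sum>j = 1..k. real (k choose j) * real a ^ (k - j)
        * ((2 ^ (j + 1) - 1) / real (j + 1)) * bernoulli (j + 1))"
proof -
  \<comment> \<open>The term \<open>j = 0\<close> is \<open>- (real a ^ k) / 2\<close>; it halves
    the boundary term of \<open>bernoulli_diff_alternating\<close>.\<close>
  have split: "(\<Sum>j\<le>k. real (k choose j) * real a ^ (k - j) * bernoulli_diff j) =
      - (real a ^ k) / 2 + (\<Sum>j = 1..k. real (k choose j) * real a ^ (k - j) * bernoulli_diff j)"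
    by (simp add: atLeast0AtMost[symmetric] sum.atLeast_Suc_atMost bernoulli_diff_0)
  have "bernoulli_diff k = (\<Sum>n<a. (- 1) ^ n * (real n + 1) ^ k) + (- 1) ^ a / 2 * real a ^ k
    + (- 1) ^ a * (\<Sum>j = 1..k. real (k choose j) * real a ^ (k - j) * bernoulli_diff j)"
    by (subst bernoulli_diff_alternating[OF \<open>k > 0\<close>, of a], subst split)
      (simp add: algebra_simps)
  then show ?thesis
    unfolding bernoulli_diff_def mult.assoc .
qed

end
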